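(* Let $\hat A$ and $\hat B$ be change actions with $\hat B$ ordered, and let $f:A\to B$ admit derivatives $\partial_\downarrow f$ and $\partial_\uparrow f$. Then every function $g:A\times\Delta A\to\Delta B$ satisfying $\partial_\downarrow f\le_\Delta g\le_\Delta\partial_\uparrow f$ (pointwise) is a derivative of $f$.
   Context: A change action $\hat A=(A,\Delta A,\oplus,+,0)$ consists of a set $A$, a monoid $(\Delta A,+,0)$ and a map $\oplus:A\times\Delta A\to A$ with $a\oplus 0=a$ and $a\oplus(\delta_1+\delta_2)=(a\oplus\delta_1)\oplus\delta_2$. A derivative of $f:A\to B$ is a function $\partial f:A\times\Delta A\to\Delta B$ with $f(a\oplus_A\delta)=f(a)\oplus_B\partial f(a,\delta)$ for all $a,\delta$. A change action $\hat B$ is ordered if $B$ and $\Delta B$ are posets and $\oplus_B:B\times\Delta B\to B$ and $+_B:\Delta B\times\Delta B\to\Delta B$ are monotone. For $\delta_1,\delta_2\in\Delta B$, $\delta_1\le_\Delta\delta_2$ means $b\oplus_B\delta_1\le b\oplus_B\delta_2$ for all $b\in B$; for functions $g,h:A\times\Delta A\to\Delta B$, $g\le_\Delta h$ means $g(a,\delta)\le_\Delta h(a,\delta)$ for all $(a,\delta)$. *)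

theory Defs
  imports "HOL-Algebra.Group"
begin

(* Base sets and monoids of changes are carriers rather than whole types, so that the base set
   may be empty. The monoid of changes (written additively on paper) is a HOL-Algebra monoid:
   its addition is mult and its zero is one. *)

record ('a, 'd) change_action =
  base :: "'a set"
  changes :: "'d monoid"
  act :: "'a \<Rightarrow> 'd \<Rightarrow> 'a" (infixl "\<oplus>\<index>" 65)

locale change_action =
  fixes A :: "('a, 'd, 'm) change_action_scheme" (structure)
  assumes monoid_changes: "monoid (changes A)"
    and act_closed: "a \<in> base A \<Longrightarrow> \<delta> \<in> carrier (changes A) \<Longrightarrow> a \<oplus> \<delta> \<in> base A"
    and act_zero: "a \<in> base A \<Longrightarrow> a \<oplus> \<one>\<^bsub>changes A\<^esub> = a"
    and act_plus: "a \<in> base A \<Longrightarrow> \<delta>\<^sub>1 \<in> carrier (changes A) \<Longrightarrow> \<delta>\<^sub>2 \<in> carrier (changes A) \<Longrightarrow>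
      a \<oplus> (\<delta>\<^sub>1 \<otimes>\<^bsub>changes A\<^esub> \<delta>\<^sub>2) = (a \<oplus> \<delta>\<^sub>1) \<oplus> \<delta>\<^sub>2"

record ('a, 'd) ordered_change_action = "('a, 'd) change_action" +
  base_order :: "'a rel"
  changes_order :: "'d rel"

definition prod_le :: "'a rel \<Rightarrow> 'b rel \<Rightarrow> 'a \<times> 'b \<Rightarrow> 'a \<times> 'b \<Rightarrow> bool" where
  "prod_le r s x y \<longleftrightarrow> (fst x, fst y) \<in> r \<and> (snd x, snd y) \<in> s"

locale ordered_change_action = change_action A
  for A :: "('a, 'd, 'm) ordered_change_action_scheme" (structure) +
  assumes base_poset: "partial_order_on (base A) (base_order A)"
    and changes_poset: "partial_order_on (carrier (changes A)) (changes_order A)"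
    and act_mono: "monotone_on (base A \<times> carrier (changes A))
      (prod_le (base_order A) (changes_order A)) (\<lambda>x y. (x, y) \<in> base_order A)
      (\<lambda>(a, \<delta>). a \<oplus> \<delta>)"
    and plus_mono: "monotone_on (carrier (changes A) \<times> carrier (changes A))
      (prod_le (changes_order A) (changes_order A)) (\<lambda>x y. (x, y) \<in> changes_order A)
      (\<lambda>(\<delta>\<^sub>1, \<delta>\<^sub>2). \<delta>\<^sub>1 \<otimes>\<^bsub>changes A\<^esub> \<delta>\<^sub>2)"

definition is_derivative ::
  "('a, 'd, 'm) change_action_scheme \<Rightarrow> ('b, 'e, 'n) change_action_scheme \<Rightarrow>
    ('a \<Rightarrow> 'b) \<Rightarrow> ('a \<times> 'd \<Rightarrow> 'e) \<Rightarrow> bool" where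
  "is_derivative A B f df \<longleftrightarrow>
    df \<in> base A \<times> carrier (changes A) \<rightarrow> carrier (changes B) \<and>
    (\<forall>a \<in> base A. \<forall>\<delta> \<in> carrier (changes A). f (a \<oplus>\<^bsub>A\<^esub> \<delta>) = f a \<oplus>\<^bsub>B\<^esub> df (a, \<delta>))"

definition change_le :: "('b, 'e, 'n) ordered_change_action_scheme \<Rightarrow> 'e \<Rightarrow> 'e \<Rightarrow> bool" where
  "change_le B \<delta>\<^sub>1 \<delta>\<^sub>2 \<longleftrightarrow> (\<forall>b \<in> base B. (b \<oplus>\<^bsub>B\<^esub> \<delta>\<^sub>1, b \<oplus>\<^bsub>B\<^esub> \<delta>\<^sub>2) \<in> base_order B)"

definition fun_change_le ::
  "('a, 'd, 'm) change_action_scheme \<Rightarrow> ('b, 'e, 'n) ordered_change_action_scheme \<Rightarrow>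
    ('a \<times> 'd \<Rightarrow> 'e) \<Rightarrow> ('a \<times> 'd \<Rightarrow> 'e) \<Rightarrow> bool" where
  "fun_change_le A B g h \<longleftrightarrow>
    (\<forall>a \<in> base A. \<forall>\<delta> \<in> carrier (changes A). change_le B (g (a, \<delta>)) (h (a, \<delta>)))"

end

theory Submission
  imports Defs
begin

text \<open>Both derivatives carry \<open>f a\<close> to the same point, the value of
  \<open>f\<close> at \<open>a\<close> acted on by \<open>\<delta>\<close>. Evaluating the two
  inequalities at the base point \<open>f a\<close> therefore squeezes the result of acting on
  \<open>f a\<close> by \<open>g (a, \<delta>)\<close> between two copies of that point, and
  antisymmetry of \<open>base_order B\<close> gives equality. The squeeze takes place in the base,
  so \<open>g\<close> itself may differ from both derivatives.\<close>

theorem mainTheorem6: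
  fixes A :: "('a, 'd) change_action" and B :: "('b, 'e) ordered_change_action"
    and f :: "'a \<Rightarrow> 'b" and df_down df_up g :: "'a \<times> 'd \<Rightarrow> 'e"
  assumes "change_action A" and "ordered_change_action B"
    and "f \<in> base A \<rightarrow> base B"
    and "is_derivative A B f df_down" and "is_derivative A B f df_up"
    and "g \<in> base A \<times> carrier (changes A) \<rightarrow> carrier (changes B)"
    and "fun_change_le A B df_down g" and "fun_change_le A B g df_up"
  shows "is_derivative A B f g"
proof -
  have anti: "antisym (base_order B)"
    using ordered_change_action.base_poset[OF assms(2)] by (simp add: partial_order_on_def)
  have "f (a \<oplus>\<^bsub>A\<^esub> \<delta>) = f a \<oplus>\<^bsub>B\<^esub> g (a, \<delta>)"
    if a: "a \<in> base A" and d: "\<delta> \<in> carrier (changes A)" for a \<delta>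
  proof (rule antisymD[OF anti])
    \<comment> \<open>\<open>change_le\<close> speaks only about points of \<open>base B\<close>;
      this fact allows its instance at \<open>f a\<close>.\<close>
    have fa: "f a \<in> base B" using assms(3) a by blast
    have down: "f (a \<oplus>\<^bsub>A\<^esub> \<delta>) = f a \<oplus>\<^bsub>B\<^esub> df_down (a, \<delta>)"
      and up: "f (a \<oplus>\<^bsub>A\<^esub> \<delta>) = f a \<oplus>\<^bsub>B\<^esub> df_up (a, \<delta>)"
      using assms(4,5) a d by (auto simp: is_derivative_def)
    \<comment> \<open>Written through \<open>df_down\<close>, the common value turns the goal into
      the lower bound on \<open>g\<close> at \<open>f a\<close>; \<open>df_up\<close> serves the
      reverse inequality in the same way.\<close>
    show "(f (a \<oplus>\<^bsub>A\<^esub> \<delta>), f a \<oplus>\<^bsub>B\<^esub> g (a, \<delta>)) \<in> base_order B"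
      unfolding down using assms(7) a d fa by (simp add: fun_change_le_def change_le_def)
    show "(f a \<oplus>\<^bsub>B\<^esub> g (a, \<delta>), f (a \<oplus>\<^bsub>A\<^esub> \<delta>)) \<in> base_order B"
      unfolding up using assms(8) a d fa by (simp add: fun_change_le_def change_le_def)
  qed
  with assms(6) show ?thesis by (simp add: is_derivative_def)
qed

end
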